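(* Let $n\ge 1$ and $k\ge 1$ be integers and let $\varphi:\{-1,1\}^n\to\mathbb{R}^{\ge 0}$ be a density function. Then $\varphi$ is $\delta$-close (in total variation distance) to some $k$-wise uniform distribution, where \[ \delta \le e^k\sqrt{\mathbf{W}^{1\dots k}[\varphi]} = e^k\sqrt{\sum_{1\le |S|\le k}\widehat{\varphi}(S)^2}. \] Consequently, if $\varphi$ is $(\epsilon,k)$-wise uniform, then $\varphi$ is $\delta$-close to some $k$-wise uniform distribution with $\delta\le e^k n^{k/2}\epsilon$. Moreover, in the special case $k=1$, if $\varphi$ is $(\epsilon,1)$-wise uniform then $\varphi$ is $\epsilon$-close to some $1$-wise uniform distribution.
   Context: A density function is a function $\varphi:\{-1,1\}^n\to\mathbb{R}^{\ge 0}$ with $\mathbb{E}_{x\sim\{-1,1\}^n}[\varphi(x)]=1$ (expectation over the uniform distribution); it corresponds to the distribution with $\Pr[x]=\varphi(x)/2^n$. Fourier coefficients: for $S\subseteq[n]$, $x^S=\prod_{i\in S}x_i$ and $\widehat{\varphi}(S)=\mathbb{E}_{x\sim\{-1,1\}^n}[\varphi(x)x^S]$. A distribution with density $\varphi$ is $k$-wise uniform iff $\widehat{\varphi}(S)=0$ for all $1\le|S|\le k$; it is $(\epsilon,k)$-wise uniform if $|\widehat{\varphi}(S)|\le\epsilon$ for all $1\le|S|\le k$. The total variation distance between densities $\varphi,\psi$ is $\frac12\mathbb{E}_{x\sim\{-1,1\}^n}|\varphi(x)-\psi(x)|$; $\varphi$ is $\delta$-close to $\psi$ if this is at most $\delta$.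 *)

theory Defs
  imports "HOL-Probability.Probability"
begin

definition cube :: "nat \<Rightarrow> (nat \<Rightarrow> real) set" where
  "cube n = {1..n} \<rightarrow>\<^sub>E {-1, 1}"

definition cube_expectation :: "nat \<Rightarrow> ((nat \<Rightarrow> real) \<Rightarrow> real) \<Rightarrow> real" where
  "cube_expectation n f = measure_pmf.expectation (pmf_of_set (cube n)) f"

lemma finite_cube [simp]: "finite (cube n)"
  by (simp add: cube_def finite_PiE)

lemma card_cube [simp]: "card (cube n) = 2 ^ n"
  by (simp add: cube_def card_PiE numeral_2_eq_2)

lemma cube_not_empty [simp]: "cube n \<noteq> {}"
  by (simp add: cube_def PiE_eq_empty_iff)

lemma cube_expectation_eq: "cube_expectation n f = (\<Sum>x\<in>cube n. f x) / 2 ^ n"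
  by (simp add: cube_expectation_def integral_pmf_of_set)

(* Functions on the cube are total functions of which only the values on cube n matter:
   every notion below depends on nothing else. *)

definition density_fn :: "nat \<Rightarrow> ((nat \<Rightarrow> real) \<Rightarrow> real) \<Rightarrow> bool" where
  "density_fn n \<phi> \<longleftrightarrow> (\<forall>x\<in>cube n. 0 \<le> \<phi> x) \<and> cube_expectation n \<phi> = 1"

definition fourier_coeff :: "nat \<Rightarrow> ((nat \<Rightarrow> real) \<Rightarrow> real) \<Rightarrow> nat set \<Rightarrow> real" where
  "fourier_coeff n \<phi> S = cube_expectation n (\<lambda>x. \<phi> x * (\<Prod>i\<in>S. x i))"

definition fourier_weight :: "nat \<Rightarrow> nat \<Rightarrow> nat \<Rightarrow> ((nat \<Rightarrow> real) \<Rightarrow> real) \<Rightarrow> real" where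
  "fourier_weight n i j \<phi> =
     (\<Sum>S | S \<subseteq> {1..n} \<and> i \<le> card S \<and> card S \<le> j. (fourier_coeff n \<phi> S)\<^sup>2)"

definition kwise_uniform :: "nat \<Rightarrow> nat \<Rightarrow> ((nat \<Rightarrow> real) \<Rightarrow> real) \<Rightarrow> bool" where
  "kwise_uniform n k \<phi> \<longleftrightarrow> density_fn n \<phi> \<and>
     (\<forall>S\<subseteq>{1..n}. 1 \<le> card S \<and> card S \<le> k \<longrightarrow> fourier_coeff n \<phi> S = 0)"

definition eps_kwise_uniform :: "nat \<Rightarrow> real \<Rightarrow> nat \<Rightarrow> ((nat \<Rightarrow> real) \<Rightarrow> real) \<Rightarrow> bool" where
  "eps_kwise_uniform n \<epsilon> k \<phi> \<longleftrightarrow> density_fn n \<phi> \<and>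
     (\<forall>S\<subseteq>{1..n}. 1 \<le> card S \<and> card S \<le> k \<longrightarrow> \<bar>fourier_coeff n \<phi> S\<bar> \<le> \<epsilon>)"

definition tv_dist ::
  "nat \<Rightarrow> ((nat \<Rightarrow> real) \<Rightarrow> real) \<Rightarrow> ((nat \<Rightarrow> real) \<Rightarrow> real) \<Rightarrow> real" where
  "tv_dist n \<phi> \<psi> = 1 / 2 * cube_expectation n (\<lambda>x. \<bar>\<phi> x - \<psi> x\<bar>)"

definition close_to ::
  "nat \<Rightarrow> real \<Rightarrow> ((nat \<Rightarrow> real) \<Rightarrow> real) \<Rightarrow> ((nat \<Rightarrow> real) \<Rightarrow> real) \<Rightarrow> bool" where
  "close_to n \<delta> \<phi> \<psi> \<longleftrightarrow> tv_dist n \<phi> \<psi> \<le> \<delta>"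

end

theory Submission
  imports Defs
begin

text \<open>A convex combination of the vectors \<open>(x\<^sup>S)\<close>, \<open>1 \<le> |S| \<le> k\<close>, equal to the negated low-degree
  coefficients of \<open>\<phi>\<close> divided by \<open>\<delta>\<close> gives a density that, mixed into \<open>\<phi>\<close> with weight
  \<open>\<delta> / (1 + \<delta>)\<close>, makes it \<open>k\<close>-wise uniform. If there is none, a separating hyperplane is a
  positive polynomial \<open>p\<close> of degree at most \<open>k\<close> with \<open>\<delta> \<cdot> E p \<le> \<parallel>p - E p\<parallel>\<^sub>2 \<cdot> \<surd>W\<close>, where \<open>W\<close> is
  the Fourier weight of \<open>\<phi>\<close> on the levels 1 to \<open>k\<close>. This contradicts
  \<open>\<parallel>p\<parallel>\<^sub>2 \<le> e\<^sup>k \<cdot> E p\<close>, which follows from the logarithmic Sobolev inequality on the cube. For \<open>k = 1\<close> a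
  positive affine function has its constant term above the sum of the absolute values of its other
  coefficients, whence the better bound.\<close>

subsection \<open>Separation from a finite set\<close>

text \<open>This is Tychonoff's theorem on the function type. It makes the simplex of weights
  compact, so that the squared distance to the target attains its minimum there.\<close>

lemma compact_PiE_UNIV:
  fixes B :: "'a \<Rightarrow> 'b::topological_space set"
  assumes "\<And>x. compact (B x)"
  shows "compact (PiE UNIV B)"
proof -
  have "compactin (product_topology (\<lambda>x. euclidean) UNIV) (PiE UNIV B)"
    using assms by (auto simp: compactin_PiE)
  then show ?thesis
    by (simp add: euclidean_product_topology)
qed

text \<open>At the point of the convex hull nearest to \<open>b\<close>, first-order optimality together with the
  hypothesis for the residual \<open>r\<close> forces \<open>r = 0\<close>.\<close>

lemma convex_combination_alternative:
  fixes v :: "'a \<Rightarrow> 'b \<Rightarrow> real" and b :: "'b \<Rightarrow> real"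
  assumes X: "finite X" "X \<noteq> {}" and J: "finite J"
    and sep: "\<And>c. \<exists>x\<in>X. (\<Sum>j\<in>J. c j * v x j) \<le> (\<Sum>j\<in>J. c j * b j)"
  obtains w where "\<And>x. 0 \<le> w x" "sum w X = 1" "\<And>j. j \<in> J \<Longrightarrow> (\<Sum>x\<in>X. w x * v x j) = b j"
proof -
  \<comment> \<open>Weights are total functions on the whole type. Pinning them to 0 outside
    \<open>X\<close> makes the box a product of compact sets over \<open>UNIV\<close>.\<close>
  define B where "B = (\<lambda>x. if x \<in> X then {0..1::real} else {0})"
  define K where "K = PiE UNIV B \<inter> {w. sum w X = 1}"
  define F where "F = (\<lambda>w. \<Sum>j\<in>J. ((\<Sum>x\<in>X. w x * v x j) - b j)\<^sup>2)"
  have coord: "continuous_on UNIV (\<lambda>w::'a \<Rightarrow> real. w x)" for x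
    by (rule continuous_on_product_coordinates)
  have "closed {w :: 'a \<Rightarrow> real. sum w X = 1}"
    by (intro closed_Collect_eq continuous_intros coord)
  then have "compact K"
    unfolding K_def by (intro compact_Int_closed compact_PiE_UNIV) (auto simp: B_def)
  moreover have "K \<noteq> {}"
  proof -
    obtain x0 where x0: "x0 \<in> X" using X by blast
    have "(\<lambda>x. if x = x0 then 1 else 0) \<in> K"
      using x0 X by (auto simp: K_def B_def PiE_iff)
    then show ?thesis by blast
  qed
  moreover have "continuous_on K F"
    unfolding F_def
    by (intro continuous_intros continuous_on_subset[OF coord]) auto
  ultimately obtain w where w: "w \<in> K" and min: "\<And>u. u \<in> K \<Longrightarrow> F w \<le> F u"
    using continuous_attains_inf by metis
  have w0: "0 \<le> w x" for x
    using w by (auto simp: K_def B_def PiE_iff split: if_splits dest!: spec[of _ x])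
  have wX: "w x = 0" if "x \<notin> X" for x
    using w that by (auto simp: K_def B_def PiE_iff split: if_splits dest!: spec[of _ x])
  have w1: "sum w X = 1" using w by (simp add: K_def)
  define r where "r = (\<lambda>j. (\<Sum>x\<in>X. w x * v x j) - b j)"
  \<comment> \<open>Up to a factor 2 this sum is the one-sided derivative of \<open>F\<close> at
    \<open>w\<close> towards the vertex \<open>y\<close> of the simplex. A minimum has no descent
    direction inside \<open>K\<close>.\<close>
  have opt: "0 \<le> (\<Sum>j\<in>J. r j * (v y j - b j - r j))" if y: "y \<in> X" for y
  proof -
    define d where "d = (\<lambda>j. v y j - b j - r j)"
    \<comment> \<open>Moving a fraction \<open>t\<close> of the weight to \<open>y\<close> changes
      the residual from \<open>r\<close> to \<open>r + t * d\<close>. The bound is the growth of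
      \<open>F\<close> divided by \<open>t\<close>.\<close>
    have quad: "0 \<le> 2 * (\<Sum>j\<in>J. r j * d j) + t * (\<Sum>j\<in>J. (d j)\<^sup>2)" if t: "0 < t" "t \<le> 1" for t
    proof -
      define u where "u = (\<lambda>x. (1 - t) * w x + (if x = y then t else 0))"
      have su: "sum u X = 1"
        using X y w1 by (simp add: u_def sum.distrib flip: sum_distrib_left)
      have u0: "0 \<le> u x" for x
        using t w0[of x] by (simp add: u_def)
      have "u x \<le> 1" if "x \<in> X" for x
        using member_le_sum[of x X u] that u0 X su by auto
      then have "u \<in> K"
        using su u0 wX y by (auto simp: K_def B_def PiE_iff u_def)
      then have "F w \<le> F u" by (rule min)
      also have "F u = (\<Sum>j\<in>J. (r j + t * d j)\<^sup>2)"
        unfolding F_def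
      proof (intro sum.cong refl arg_cong[where f = "\<lambda>z. z\<^sup>2"])
        fix j
        have "(\<Sum>x\<in>X. u x * v x j) = (\<Sum>x\<in>X. (1 - t) * (w x * v x j) + (if x = y then t * v x j else 0))"
          by (intro sum.cong refl) (auto simp: u_def algebra_simps)
        also have "\<dots> = (1 - t) * (\<Sum>x\<in>X. w x * v x j) + t * v y j"
          using X y by (simp add: sum.distrib flip: sum_distrib_left)
        finally show "(\<Sum>x\<in>X. u x * v x j) - b j = r j + t * d j"
          by (simp add: r_def d_def algebra_simps)
      qed
      also have "\<dots> = F w + t * (2 * (\<Sum>j\<in>J. r j * d j) + t * (\<Sum>j\<in>J. (d j)\<^sup>2))"
      proof -
        have "F w = (\<Sum>j\<in>J. (r j)\<^sup>2)" by (simp add: F_def r_def)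
        then show ?thesis
          by (simp add: power2_eq_square algebra_simps sum.distrib sum_distrib_left)
      qed
      finally show ?thesis
        using t by (simp add: zero_le_mult_iff)
    qed
    have "((\<lambda>t. 2 * (\<Sum>j\<in>J. r j * d j) + t * (\<Sum>j\<in>J. (d j)\<^sup>2)) \<longlongrightarrow>
           2 * (\<Sum>j\<in>J. r j * d j) + 0 * (\<Sum>j\<in>J. (d j)\<^sup>2)) (at_right 0)"
      by (intro tendsto_intros)
    moreover have "eventually (\<lambda>t. 0 \<le> 2 * (\<Sum>j\<in>J. r j * d j) + t * (\<Sum>j\<in>J. (d j)\<^sup>2)) (at_right (0::real))"
      unfolding eventually_at_right_field using quad by (intro exI[of _ 1]) auto
    ultimately have "0 \<le> 2 * (\<Sum>j\<in>J. r j * d j) + 0 * (\<Sum>j\<in>J. (d j)\<^sup>2)"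
      by (rule tendsto_lowerbound) simp
    then show ?thesis by (simp add: d_def)
  qed
  obtain y where y: "y \<in> X" "(\<Sum>j\<in>J. r j * v y j) \<le> (\<Sum>j\<in>J. r j * b j)"
    using sep by blast
  \<comment> \<open>The hypothesis \<open>sep\<close> with \<open>c = r\<close> makes the sum of
    \<open>r j * (v y j - b j)\<close> nonpositive, so \<open>opt\<close> leaves only minus the sum
    of the squares of \<open>r\<close>.\<close>
  have "(\<Sum>j\<in>J. (r j)\<^sup>2) \<le> 0"
    using opt[OF y(1)] y(2) by (simp add: algebra_simps sum.distrib sum_subtractf power2_eq_square)
  then have "r j = 0" if "j \<in> J" for j
    using that J sum_nonneg_eq_0_iff[of J "\<lambda>j. (r j)\<^sup>2"] by (force intro: antisym sum_nonneg)
  then show ?thesis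
    using that[OF w0 w1] by (simp add: r_def)
qed

subsection \<open>Logarithmic Sobolev inequality\<close>

text \<open>With e = 1 - t the claim is exp (-e) <= 1 - e + e^2/2. The product (1 + e + e^2/2) (1 -
  e + e^2/2) equals 1 + e^4/4, and its first factor is at most exp e.\<close>

lemma one_plus_square_ge_exp:
  fixes t :: real
  assumes "t \<le> 1"
  shows "exp (t - 1) \<le> (1 + t\<^sup>2) / 2"
proof -
  define e where "e = 1 - t"
  have e: "0 \<le> e" using assms by (simp add: e_def)
  have q: "1 + e + e\<^sup>2 / 2 \<le> exp e" using exp_lower_Taylor_quadratic[OF e] .
  have "1 \<le> (1 + e + e\<^sup>2 / 2) * (1 - e + e\<^sup>2 / 2)"
    using zero_le_power[OF e, of 4] by (simp add: algebra_simps power2_eq_square power4_eq_xxxx)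
  also have "\<dots> \<le> exp e * (1 - e + e\<^sup>2 / 2)"
  proof (rule mult_right_mono[OF q])
    have "0 \<le> ((1 - e)\<^sup>2 + 1) / 2" by simp
    then show "0 \<le> 1 - e + e\<^sup>2 / 2" by (simp add: power2_eq_square algebra_simps)
  qed
  finally have "exp (- e) \<le> 1 - e + e\<^sup>2 / 2"
    by (simp add: exp_minus field_simps)
  then show ?thesis
    by (simp add: e_def power2_eq_square field_simps)
qed

text \<open>By symmetry let b <= a. For b > 0 the difference \<open>G\<close> of the two sides
  vanishes at a = b and is nondecreasing for a >= b: the sign of its derivative is the preceding
  lemma at t = b / z.\<close>

lemma two_point_log_sobolev:
  fixes a b :: real
  assumes "0 \<le> a" "0 \<le> b"
  shows "a\<^sup>2 * ln (a\<^sup>2) + b\<^sup>2 * ln (b\<^sup>2) - (a\<^sup>2 + b\<^sup>2) * ln ((a\<^sup>2 + b\<^sup>2) / 2) \<le> (a - b)\<^sup>2"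
  using assms
proof (induction a b rule: linorder_wlog)
  case (sym a b)
  then show ?case by (simp add: algebra_simps power2_commute)
next
  case (le b a)
  consider "a = 0" | "b = 0" "a > 0" | "b > 0" using le by fastforce
  then show ?case
  proof cases
    case 1
    then show ?thesis using le by simp
  next
    case 2
    \<comment> \<open>The term 0 * ln 0 is 0, so for b = 0 the inequality reads a^2 * ln 2 <=
      a^2.\<close>
    have "ln (2::real) \<le> 1" using ln_le_minus_one[of 2] by simp
    then show ?thesis using 2 by (simp add: ln_div algebra_simps mult_left_le)
  next
    case 3
    define G where "G = (\<lambda>a. (a - b)\<^sup>2 - 2 * a\<^sup>2 * ln a - 2 * b\<^sup>2 * ln b
      + (a\<^sup>2 + b\<^sup>2) * ln ((a\<^sup>2 + b\<^sup>2) / 2))"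
    have "G b \<le> G a"
    proof (rule DERIV_nonneg_imp_nondecreasing[OF \<open>b \<le> a\<close>])
      fix z assume z: "b \<le> z" "z \<le> a"
      have "exp (b / z - 1) \<le> (1 + (b / z)\<^sup>2) / 2"
        using 3 z by (intro one_plus_square_ge_exp) simp
      also have "\<dots> = (z\<^sup>2 + b\<^sup>2) / 2 / z\<^sup>2"
        using 3 z by (simp add: field_simps)
      finally have "b / z - 1 \<le> ln ((z\<^sup>2 + b\<^sup>2) / 2 / z\<^sup>2)"
        using 3 z by (subst ln_ge_iff) (auto intro!: divide_pos_pos add_pos_pos)
      also have "\<dots> = ln ((z\<^sup>2 + b\<^sup>2) / 2) - 2 * ln z"
        using 3 z by (subst ln_div) (auto simp: add_pos_pos ln_realpow intro!: divide_pos_pos add_pos_pos)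
      finally have nonneg: "0 \<le> 2 * z * (1 - b / z + ln ((z\<^sup>2 + b\<^sup>2) / 2) - 2 * ln z)"
        using 3 z by simp
      have "((\<lambda>a. (a\<^sup>2 + b\<^sup>2) * ln ((a\<^sup>2 + b\<^sup>2) / 2)) has_real_derivative
          2 * z * ln ((z\<^sup>2 + b\<^sup>2) / 2) + 2 * z) (at z)"
      proof -
        have "z\<^sup>2 + b\<^sup>2 > 0" using 3 z by (simp add: add_pos_pos)
        then show ?thesis by (auto intro!: derivative_eq_intros)
      qed
      then have G: "(G has_real_derivative
          2 * (z - b) - 4 * z * ln z - 2 * z + 2 * z * ln ((z\<^sup>2 + b\<^sup>2) / 2) + 2 * z) (at z)"
        unfolding G_def using 3 z
        by (auto elim!: DERIV_cong[OF DERIV_add, rotated] intro!: derivative_eq_intros simp: power2_eq_square)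
      have "0 \<le> 2 * (z - b) - 4 * z * ln z - 2 * z + 2 * z * ln ((z\<^sup>2 + b\<^sup>2) / 2) + 2 * z"
        using 3 z nonneg by (simp add: algebra_simps)
      with G show "\<exists>y. (G has_real_derivative y) (at z) \<and> 0 \<le> y"
        by blast
    qed
    moreover have "G b = 0" using 3 by (simp add: G_def ln_realpow)
    ultimately show ?thesis
      using 3 le by (simp add: G_def ln_realpow power2_commute algebra_simps)
  qed
qed

section \<open>Fourier expansions on the cube, by induction on the dimension\<close>

definition cube_poly :: "nat \<Rightarrow> (nat set \<Rightarrow> real) \<Rightarrow> (nat \<Rightarrow> real) \<Rightarrow> real" where
  "cube_poly n c x = (\<Sum>S\<in>Pow {1..n}. c S * (\<Prod>i\<in>S. x i))"

lemma sum_Pow_Suc: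
  "(\<Sum>S\<in>Pow {1..Suc n}. h S) = (\<Sum>S\<in>Pow {1..n}. h S + h (insert (Suc n) S))"
  for h :: "nat set \<Rightarrow> 'a::comm_monoid_add"
proof -
  have "{1..Suc n} = insert (Suc n) {1..n}" by auto
  moreover have "inj_on (insert (Suc n)) (Pow {1..n})"
    by (rule inj_onI) (metis Diff_insert_absorb PowD Suc_n_not_le_n atLeastAtMost_iff subset_iff)
  moreover have "Pow {1..n} \<inter> insert (Suc n) ` Pow {1..n} = {}" by fastforce
  ultimately show ?thesis
    by (simp add: Pow_insert sum.union_disjoint sum.reindex sum.distrib)
qed

text \<open>Fixing the last coordinate merges the coefficients of \<open>S\<close> and
  \<open>insert (Suc n) S\<close>. With \<open>cube_expectation_Suc\<close> this reduces a statement
  on the cube to the coefficient functions c + d and c - d one dimension lower, where d S is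
  \<open>c (insert (Suc n) S)\<close>.\<close>

lemma cube_poly_Suc:
  "cube_poly (Suc n) c (x(Suc n := t)) = cube_poly n (\<lambda>S. c S + t * c (insert (Suc n) S)) x"
  unfolding cube_poly_def sum_Pow_Suc
proof (rule sum.cong[OF refl])
  fix S assume "S \<in> Pow {1..n}"
  then have S: "finite S" "Suc n \<notin> S" by (auto intro: finite_subset)
  then have "(\<Prod>i\<in>S. (x(Suc n := t)) i) = (\<Prod>i\<in>S. x i)"
    by (intro prod.cong) auto
  with S show "c S * (\<Prod>i\<in>S. (x(Suc n := t)) i) + c (insert (Suc n) S) * (\<Prod>i\<in>insert (Suc n) S. (x(Suc n := t)) i)
    = (c S + t * c (insert (Suc n) S)) * (\<Prod>i\<in>S. x i)"
    by (simp add: algebra_simps)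
qed

lemma cube_expectation_Suc:
  "cube_expectation (Suc n) f =
    (cube_expectation n (\<lambda>x. f (x(Suc n := 1))) + cube_expectation n (\<lambda>x. f (x(Suc n := -1)))) / 2"
proof -
  have "{1..Suc n} = insert (Suc n) {1..n}" by auto
  then have "cube (Suc n) = (\<lambda>(t, x). x(Suc n := t)) ` ({-1, 1} \<times> cube n)"
    by (simp only: cube_def PiE_insert_eq)
  moreover have "inj_on (\<lambda>(t, x). x(Suc n := t)) ({-1, 1::real} \<times> cube n)"
    unfolding cube_def by (rule inj_combinator) simp
  ultimately have "(\<Sum>x\<in>cube (Suc n). f x) = (\<Sum>(t, x)\<in>{-1, 1} \<times> cube n. f (x(Suc n := t)))"
    by (simp add: sum.reindex case_prod_unfold)
  also have "\<dots> = (\<Sum>t\<in>{-1, 1}. \<Sum>x\<in>cube n. f (x(Suc n := t)))"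
    by (simp add: sum.cartesian_product)
  finally show ?thesis
    by (simp add: cube_expectation_eq field_simps)
qed

lemma cube_expectation_0: "cube_expectation 0 f = f (\<lambda>_. undefined)"
  by (simp add: cube_expectation_eq cube_def)

lemma cube_expectation_add:
  "cube_expectation n (\<lambda>x. f x + g x) = cube_expectation n f + cube_expectation n g"
  by (simp add: cube_expectation_eq sum.distrib add_divide_distrib)

lemma cube_expectation_cmult: "cube_expectation n (\<lambda>x. a * f x) = a * cube_expectation n f"
  by (simp add: cube_expectation_eq sum_distrib_left)

lemma cube_expectation_const: "cube_expectation n (\<lambda>x. a) = a"
  by (simp add: cube_expectation_eq)

lemma cube_expectation_mono:
  "(\<And>x. x \<in> cube n \<Longrightarrow> f x \<le> g x) \<Longrightarrow> cube_expectation n f \<le> cube_expectation n g"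
  by (simp add: cube_expectation_eq divide_right_mono sum_mono)

lemma cube_expectation_poly: "cube_expectation n (cube_poly n c) = c {}"
proof (induction n arbitrary: c)
  case 0
  then show ?case by (simp add: cube_expectation_0 cube_poly_def)
next
  case (Suc n)
  then show ?case by (simp add: cube_expectation_Suc cube_poly_Suc)
qed

text \<open>Averaging over the two halves preserves the sum of squares by the parallelogram identity
  (c + d)^2 + (c - d)^2 = 2 c^2 + 2 d^2.\<close>

lemma parseval: "cube_expectation n (\<lambda>x. (cube_poly n c x)\<^sup>2) = (\<Sum>S\<in>Pow {1..n}. (c S)\<^sup>2)"
proof (induction n arbitrary: c)
  case 0
  then show ?case by (simp add: cube_expectation_0 cube_poly_def)
next
  case (Suc n)
  show ?case
    unfolding cube_expectation_Suc cube_poly_Suc Suc.IH sum_Pow_Suc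
      sum.distrib[symmetric] sum_divide_distrib
    by (intro sum.cong refl) (simp add: power2_eq_square field_simps)
qed

text \<open>The two roots are the Euclidean norms of f + g and f - g, which differ by 2 g. The
  triangle inequality is applied in both directions.\<close>

lemma square_diff_sqrt_sums_le:
  fixes f g :: "'a \<Rightarrow> real"
  shows "(sqrt (\<Sum>i\<in>A. (f i + g i)\<^sup>2) - sqrt (\<Sum>i\<in>A. (f i - g i)\<^sup>2))\<^sup>2 \<le> 4 * (\<Sum>i\<in>A. (g i)\<^sup>2)"
proof -
  define p m d where "p = L2_set (\<lambda>i. f i + g i) A" "m = L2_set (\<lambda>i. f i - g i) A" "d = L2_set (\<lambda>i. 2 * g i) A"
  have "(\<lambda>i. f i - g i + 2 * g i) = (\<lambda>i. f i + g i)" "(\<lambda>i. f i + g i + - (2 * g i)) = (\<lambda>i. f i - g i)"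
    by auto
  then have "p \<le> m + d" "m \<le> p + L2_set (\<lambda>i. - (2 * g i)) A"
    using L2_set_triangle_ineq[of "\<lambda>i. f i - g i" "\<lambda>i. 2 * g i" A]
      L2_set_triangle_ineq[of "\<lambda>i. f i + g i" "\<lambda>i. - (2 * g i)" A]
    by (simp_all add: p_m_d_def)
  moreover have "L2_set (\<lambda>i. - (2 * g i)) A = d" by (simp add: p_m_d_def L2_set_def)
  ultimately have "(p - m)\<^sup>2 \<le> d\<^sup>2"
    by (intro abs_le_square_iff[THEN iffD1]) auto
  also have "d\<^sup>2 = 4 * (\<Sum>i\<in>A. (g i)\<^sup>2)"
    by (simp add: p_m_d_def L2_set_def sum_nonneg power_mult_distrib sum_distrib_left)
  finally show ?thesis by (simp add: p_m_d_def L2_set_def)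
qed

text \<open>In the induction step, the two-point inequality is applied to the 2-norms of the restrictions of
  the polynomial to the two halves of the cube.\<close>

lemma log_sobolev:
  "cube_expectation n (\<lambda>x. (cube_poly n c x)\<^sup>2 * ln ((cube_poly n c x)\<^sup>2))
    - (\<Sum>S\<in>Pow {1..n}. (c S)\<^sup>2) * ln (\<Sum>S\<in>Pow {1..n}. (c S)\<^sup>2)
   \<le> 2 * (\<Sum>S\<in>Pow {1..n}. real (card S) * (c S)\<^sup>2)"
proof (induction n arbitrary: c)
  case 0
  then show ?case by (simp add: cube_expectation_0 cube_poly_def)
next
  case (Suc n)
  define d where "d = (\<lambda>S. c (insert (Suc n) S))"
  \<comment> \<open>By \<open>parseval\<close>, these are the mean squares of the polynomial on the
    halves where the last coordinate is 1 and -1.\<close>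
  define u v where "u = (\<Sum>S\<in>Pow {1..n}. (c S + d S)\<^sup>2)" and "v = (\<Sum>S\<in>Pow {1..n}. (c S - d S)\<^sup>2)"
  define E where "E = (\<lambda>c. cube_expectation n (\<lambda>x. (cube_poly n c x)\<^sup>2 * ln ((cube_poly n c x)\<^sup>2)))"
  have uv: "0 \<le> u" "0 \<le> v" by (auto simp: u_def v_def intro!: sum_nonneg)
  have total: "(\<Sum>S\<in>Pow {1..Suc n}. (c S)\<^sup>2) = (u + v) / 2"
    unfolding sum_Pow_Suc u_def v_def d_def sum.distrib[symmetric] sum_divide_distrib
    by (intro sum.cong refl) (simp add: power2_eq_square field_simps)
  have "E (\<lambda>S. c S + d S) - u * ln u \<le> 2 * (\<Sum>S\<in>Pow {1..n}. real (card S) * (c S + d S)\<^sup>2)"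
    using Suc.IH[of "\<lambda>S. c S + d S"] by (simp add: u_def E_def)
  moreover have "E (\<lambda>S. c S - d S) - v * ln v \<le> 2 * (\<Sum>S\<in>Pow {1..n}. real (card S) * (c S - d S)\<^sup>2)"
    using Suc.IH[of "\<lambda>S. c S - d S"] by (simp add: v_def E_def)
  moreover have "u * ln u + v * ln v - (u + v) * ln ((u + v) / 2) \<le> 4 * (\<Sum>S\<in>Pow {1..n}. (d S)\<^sup>2)"
    using two_point_log_sobolev[of "sqrt u" "sqrt v"] square_diff_sqrt_sums_le[of c d "Pow {1..n}", folded u_def v_def] uv
    by simp
  \<comment> \<open>A set containing \<open>Suc n\<close> has one element more than its trace on
    \<open>{1..n}\<close>. The extra squares of \<open>d\<close> absorb exactly the loss in the
    two-point inequality.\<close>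
  moreover have "(\<Sum>S\<in>Pow {1..n}. real (card S) * (c S + d S)\<^sup>2) + (\<Sum>S\<in>Pow {1..n}. real (card S) * (c S - d S)\<^sup>2)
      + 2 * (\<Sum>S\<in>Pow {1..n}. (d S)\<^sup>2) = 2 * (\<Sum>S\<in>Pow {1..Suc n}. real (card S) * (c S)\<^sup>2)"
  proof -
    have "card (insert (Suc n) S) = Suc (card S)" if "S \<in> Pow {1..n}" for S
      using that by (subst card_insert_disjoint) (auto intro: finite_subset)
    then show ?thesis
      unfolding sum_Pow_Suc sum_distrib_left sum.distrib[symmetric] d_def
      by (intro sum.cong refl) (simp add: power2_eq_square algebra_simps)
  qed
  moreover have "cube_expectation (Suc n) (\<lambda>x. (cube_poly (Suc n) c x)\<^sup>2 * ln ((cube_poly (Suc n) c x)\<^sup>2))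
      = (E (\<lambda>S. c S + d S) + E (\<lambda>S. c S - d S)) / 2"
    by (simp add: cube_expectation_Suc cube_poly_Suc E_def d_def)
  ultimately show ?case
    unfolding total times_divide_eq_left by argo
qed

text \<open>Jensen's inequality for \<open>ln\<close> under the weight \<open>f\<^sup>2\<close> turns the entropy bound of the
  log-Sobolev inequality into a bound of the 2-norm by the 1-norm.\<close>

lemma L2_le_exp_L1:
  assumes deg: "\<And>S. S \<subseteq> {1..n} \<Longrightarrow> k < card S \<Longrightarrow> c S = 0"
    and pos: "\<And>x. x \<in> cube n \<Longrightarrow> 0 < cube_poly n c x"
  shows "(\<Sum>S\<in>Pow {1..n}. (c S)\<^sup>2) \<le> (exp 1 ^ k * c {})\<^sup>2"
proof -
  define N where "N = (\<Sum>S\<in>Pow {1..n}. (c S)\<^sup>2)"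
  define f where "f = cube_poly n c"
  have "0 < (\<Sum>x\<in>cube n. f x)" using pos by (intro sum_pos) (auto simp: f_def)
  then have "0 < cube_expectation n f" by (simp add: cube_expectation_eq)
  then have A: "0 < c {}" by (simp add: f_def cube_expectation_poly)
  have "(c {})\<^sup>2 \<le> N" unfolding N_def by (rule member_le_sum) auto
  with A have N: "0 < N" by (smt (verit) zero_less_power)
  \<comment> \<open>Under the weight f^2 / N the mean of 1 / f is \<open>c {} / N\<close>, because
    the expectation of f is \<open>c {}\<close>. Hence the tangent bound ln (s / f) <= s / f - 1,
    taken at this mean, has a right side that averages to 0.\<close>
  define s where "s = N / c {}"
  have s: "0 < s" using A N by (simp add: s_def)
  have "2 * ln s * (f x)\<^sup>2 \<le> (f x)\<^sup>2 * ln ((f x)\<^sup>2) + 2 * s * f x + (-2) * (f x)\<^sup>2" if "x \<in> cube n" for x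
  proof -
    have f: "0 < f x" using pos that by (simp add: f_def)
    then have "2 * (f x)\<^sup>2 * ln (s / f x) \<le> 2 * (f x)\<^sup>2 * (s / f x - 1)"
      using s by (intro mult_left_mono ln_le_minus_one) auto
    moreover have "ln ((f x)\<^sup>2) = 2 * ln (f x)" using f by (simp add: ln_realpow)
    ultimately show ?thesis
      using f s by (simp add: ln_div algebra_simps power2_eq_square)
  qed
  then have "cube_expectation n (\<lambda>x. 2 * ln s * (f x)\<^sup>2) \<le>
      cube_expectation n (\<lambda>x. (f x)\<^sup>2 * ln ((f x)\<^sup>2) + 2 * s * f x + (-2) * (f x)\<^sup>2)"
    by (rule cube_expectation_mono)
  then
  have "2 * ln s * N \<le> cube_expectation n (\<lambda>x. (f x)\<^sup>2 * ln ((f x)\<^sup>2)) + (2 * s * c {} - 2 * N)"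
    unfolding cube_expectation_add cube_expectation_cmult parseval[of n c, folded f_def N_def]
      cube_expectation_poly[of n c, folded f_def] by simp
  also have "2 * s * c {} - 2 * N = 0" using A by (simp add: s_def)
  also have "cube_expectation n (\<lambda>x. (f x)\<^sup>2 * ln ((f x)\<^sup>2)) \<le>
      N * ln N + 2 * (\<Sum>S\<in>Pow {1..n}. real (card S) * (c S)\<^sup>2)"
    using log_sobolev[of n c, folded f_def N_def] by simp
  also have "(\<Sum>S\<in>Pow {1..n}. real (card S) * (c S)\<^sup>2) \<le> real k * N"
    unfolding N_def sum_distrib_left
  proof (rule sum_mono)
    fix S assume "S \<in> Pow {1..n}"
    then show "real (card S) * (c S)\<^sup>2 \<le> real k * (c S)\<^sup>2"
      using deg[of S] by (cases "card S \<le> k") (auto intro: mult_right_mono)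
  qed
  finally have "N * (2 * ln s) \<le> N * (ln N + 2 * real k)"
    by (simp add: algebra_simps)
  then have "ln N \<le> 2 * (real k + ln (c {}))"
    using N A by (simp add: s_def ln_div)
  also have "\<dots> = ln ((exp 1 ^ k * c {})\<^sup>2)"
    using A by (simp add: ln_realpow ln_mult)
  finally show ?thesis
    using N A by (simp add: N_def)
qed

subsection \<open>Correcting a density\<close>

text \<open>This covers the degenerate distance 0, where the mixture below would divide by
  0.\<close>

lemma kwise_uniform_self:
  assumes "density_fn n \<phi>" "\<And>S. S \<subseteq> {1..n} \<Longrightarrow> 1 \<le> card S \<Longrightarrow> card S \<le> k \<Longrightarrow> fourier_coeff n \<phi> S = 0"
  shows "kwise_uniform n k \<phi> \<and> close_to n 0 \<phi> \<phi>"
  using assms by (auto simp: kwise_uniform_def close_to_def tv_dist_def cube_expectation_const)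

text \<open>Mixing \<open>\<phi>\<close> with a density whose low-degree coefficients are those of
  \<open>-\<phi> / \<delta>\<close> cancels the low-degree coefficients.\<close>

lemma kwise_uniform_mixture:
  assumes \<phi>: "density_fn n \<phi>" and \<delta>: "0 < \<delta>"
    and sep: "\<And>c. \<exists>x\<in>cube n.
      \<delta> * (\<Sum>S | S \<subseteq> {1..n} \<and> 1 \<le> card S \<and> card S \<le> k. c S * (\<Prod>i\<in>S. x i))
      \<le> - (\<Sum>S | S \<subseteq> {1..n} \<and> 1 \<le> card S \<and> card S \<le> k. c S * fourier_coeff n \<phi> S)"
  shows "\<exists>\<psi>. kwise_uniform n k \<psi> \<and> close_to n \<delta> \<phi> \<psi>"
proof -
  define J where "J = {S. S \<subseteq> {1..n} \<and> 1 \<le> card S \<and> card S \<le> k}"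
  have J: "finite J" by (auto simp: J_def intro: finite_subset[of _ "Pow {1..n}"])
  have sep': "\<exists>x\<in>cube n. (\<Sum>S\<in>J. c S * (\<Prod>i\<in>S. x i)) \<le> (\<Sum>S\<in>J. c S * (- fourier_coeff n \<phi> S / \<delta>))" for c
  proof -
    obtain x where x: "x \<in> cube n"
      "\<delta> * (\<Sum>S\<in>J. c S * (\<Prod>i\<in>S. x i)) \<le> - (\<Sum>S\<in>J. c S * fourier_coeff n \<phi> S)"
      using sep[of c] by (auto simp: J_def)
    have "(\<Sum>S\<in>J. c S * (\<Prod>i\<in>S. x i)) \<le> - (\<Sum>S\<in>J. c S * fourier_coeff n \<phi> S) / \<delta>"
      using x(2) \<delta> by (simp only: pos_le_divide_eq mult.commute)
    also have "\<dots> = (\<Sum>S\<in>J. c S * (- fourier_coeff n \<phi> S / \<delta>))"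
      by (simp add: sum_divide_distrib sum_negf)
    finally show ?thesis using x(1) by blast
  qed
  obtain w where w: "\<And>x. 0 \<le> w x" "sum w (cube n) = 1"
    "\<And>S. S \<in> J \<Longrightarrow> (\<Sum>x\<in>cube n. w x * (\<Prod>i\<in>S. x i)) = - fourier_coeff n \<phi> S / \<delta>"
    by (rule convex_combination_alternative[OF finite_cube cube_not_empty J sep']) (rule that)
  \<comment> \<open>The factor \<open>2 ^ n\<close> turns point probabilities into a density
    relative to the uniform distribution.\<close>
  define \<eta> where "\<eta> = (\<lambda>x. 2 ^ n * w x)"
  have \<eta>: "0 \<le> \<eta> x" "cube_expectation n \<eta> = 1" for x
    using w by (auto simp: \<eta>_def cube_expectation_eq simp flip: sum_distrib_left)
  have \<eta>_coeff: "\<delta> * fourier_coeff n \<eta> S = - fourier_coeff n \<phi> S" if "S \<in> J" for S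
  proof -
    have "fourier_coeff n \<eta> S = (\<Sum>x\<in>cube n. w x * (\<Prod>i\<in>S. x i))"
      by (simp add: fourier_coeff_def \<eta>_def cube_expectation_eq mult.assoc flip: sum_distrib_left)
    then show ?thesis using w(3)[OF that] \<delta> by simp
  qed
  have \<phi>0: "0 \<le> \<phi> x" if "x \<in> cube n" for x using \<phi> that by (simp add: density_fn_def)
  have \<phi>1: "cube_expectation n \<phi> = 1" using \<phi> by (simp add: density_fn_def)
  define \<psi> where "\<psi> = (\<lambda>x. 1 / (1 + \<delta>) * (\<phi> x + \<delta> * \<eta> x))"
  have "cube_expectation n \<psi> = 1 / (1 + \<delta>) * (cube_expectation n \<phi> + \<delta> * cube_expectation n \<eta>)"
    unfolding \<psi>_def by (simp only: cube_expectation_add cube_expectation_cmult)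
  then have "density_fn n \<psi>"
    using \<delta> \<phi>0 \<phi>1 \<eta> by (simp add: density_fn_def \<psi>_def)
  moreover have "fourier_coeff n \<psi> S = 0" if "S \<in> J" for S
  proof -
    have "fourier_coeff n \<psi> S = cube_expectation n (\<lambda>x. 1 / (1 + \<delta>) *
        (\<phi> x * (\<Prod>i\<in>S. x i) + \<delta> * (\<eta> x * (\<Prod>i\<in>S. x i))))"
      by (simp add: fourier_coeff_def \<psi>_def algebra_simps)
    also have "\<dots> = 1 / (1 + \<delta>) * (fourier_coeff n \<phi> S + \<delta> * fourier_coeff n \<eta> S)"
      unfolding fourier_coeff_def by (simp only: cube_expectation_add cube_expectation_cmult)
    finally show ?thesis using \<eta>_coeff[OF that] by simp
  qed
  moreover have "close_to n \<delta> \<phi> \<psi>"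
  proof -
    \<comment> \<open>The factor 1 / (1 + \<delta>) is dropped. Both densities have mean 1, so the
      right side averages to 2 \<delta>, which the factor 1/2 in \<open>tv_dist\<close> reduces to
      \<delta>.\<close>
    have "\<bar>\<phi> x - \<psi> x\<bar> \<le> \<delta> * (\<phi> x + \<eta> x)" if x: "x \<in> cube n" for x
    proof -
      have "\<bar>\<phi> x - \<psi> x\<bar> = \<delta> / (1 + \<delta>) * \<bar>\<phi> x - \<eta> x\<bar>"
      proof -
        have "\<phi> x - \<psi> x = \<delta> / (1 + \<delta>) * (\<phi> x - \<eta> x)"
          using \<delta> by (simp add: \<psi>_def field_simps)
        then show ?thesis using \<delta> by (simp add: abs_mult)
      qed
      also have "\<dots> \<le> \<delta> * (\<phi> x + \<eta> x)"
        using \<delta> \<phi>0[OF x] \<eta>(1)[of x] by (intro mult_mono) (auto simp: field_simps)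
      finally show ?thesis .
    qed
    then have "cube_expectation n (\<lambda>x. \<bar>\<phi> x - \<psi> x\<bar>) \<le> cube_expectation n (\<lambda>x. \<delta> * (\<phi> x + \<eta> x))"
      by (rule cube_expectation_mono)
    also have "\<dots> = 2 * \<delta>"
      by (simp only: cube_expectation_add cube_expectation_cmult \<phi>1 \<eta>) simp
    finally show ?thesis by (simp add: close_to_def tv_dist_def)
  qed
  ultimately show ?thesis by (auto simp: kwise_uniform_def J_def)
qed

lemma kwise_uniform_near_fourier_weight:
  assumes \<phi>: "density_fn n \<phi>"
  shows "\<exists>\<psi>. kwise_uniform n k \<psi> \<and> close_to n (exp 1 ^ k * sqrt (fourier_weight n 1 k \<phi>)) \<phi> \<psi>"
proof -
  define J where "J = {S. S \<subseteq> {1..n} \<and> 1 \<le> card S \<and> card S \<le> k}"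
  have J: "finite J" by (auto simp: J_def intro: finite_subset[of _ "Pow {1..n}"])
  define W where "W = (\<Sum>S\<in>J. (fourier_coeff n \<phi> S)\<^sup>2)"
  have weight: "fourier_weight n 1 k \<phi> = W"
    by (simp add: fourier_weight_def W_def J_def)
  have W0: "0 \<le> W" by (simp add: W_def sum_nonneg)
  show ?thesis
  proof (cases "W = 0")
    case True
    then have "fourier_coeff n \<phi> S = 0" if "S \<in> J" for S
      using that J by (auto simp: W_def sum_nonneg_eq_0_iff)
    then show ?thesis
      unfolding weight True using kwise_uniform_self[OF \<phi>, of k] by (auto simp: J_def)
  next
    case False
    define \<delta> where "\<delta> = exp 1 ^ k * sqrt W"
    have \<delta>: "0 < \<delta>" using False W0 by (simp add: \<delta>_def)
    have "\<exists>x\<in>cube n. \<delta> * (\<Sum>S\<in>J. c S * (\<Prod>i\<in>S. x i)) \<le> - (\<Sum>S\<in>J. c S * fourier_coeff n \<phi> S)" for c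
    proof (rule ccontr)
      assume "\<not> ?thesis"
      then have neg: "- (\<Sum>S\<in>J. c S * fourier_coeff n \<phi> S) < \<delta> * (\<Sum>S\<in>J. c S * (\<Prod>i\<in>S. x i))"
        if "x \<in> cube n" for x
        using that by (auto simp: not_le)
      define a where "a = (\<Sum>S\<in>J. c S * fourier_coeff n \<phi> S)"
      \<comment> \<open>The constant term \<open>a\<close> turns the failed inequality into
        positivity of \<open>p\<close> on the whole cube. It is also the mean of \<open>p\<close>,
        hence positive.\<close>
      define p where "p = (\<lambda>S. if S = {} then a else if S \<in> J then \<delta> * c S else 0)"
      have split: "(\<Sum>S\<in>Pow {1..n}. h S) = h {} + (\<Sum>S\<in>J. h S)"
        if "\<And>S. S \<noteq> {} \<Longrightarrow> S \<notin> J \<Longrightarrow> h S = 0" for h :: "nat set \<Rightarrow> real"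
      proof -
        have "(\<Sum>S\<in>Pow {1..n}. h S) = sum h (insert {} J)"
          using that by (intro sum.mono_neutral_right) (auto simp: J_def)
        then show ?thesis using J by (simp add: J_def)
      qed
      have J': "{} \<notin> J" by (simp add: J_def)
      have poly: "cube_poly n p x = a + \<delta> * (\<Sum>S\<in>J. c S * (\<Prod>i\<in>S. x i))" for x
      proof -
        have "cube_poly n p x = a + (\<Sum>S\<in>J. p S * (\<Prod>i\<in>S. x i))"
          unfolding cube_poly_def by (subst split) (auto simp: p_def)
        also have "(\<Sum>S\<in>J. p S * (\<Prod>i\<in>S. x i)) = \<delta> * (\<Sum>S\<in>J. c S * (\<Prod>i\<in>S. x i))"
          using J' by (auto simp: p_def sum_distrib_left mult.assoc intro!: sum.cong)
        finally show ?thesis .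
      qed
      have pos: "0 < cube_poly n p x" if "x \<in> cube n" for x
        using neg[OF that] by (simp add: poly a_def)
      have "0 < (\<Sum>x\<in>cube n. cube_poly n p x)" using pos by (intro sum_pos) auto
      then have "0 < cube_expectation n (cube_poly n p)" by (simp add: cube_expectation_eq)
      then have a: "0 < a" by (simp add: cube_expectation_poly p_def)
      have "a \<le> L2_set c J * sqrt W"
      proof -
        have "a \<le> (\<Sum>S\<in>J. \<bar>c S\<bar> * \<bar>fourier_coeff n \<phi> S\<bar>)"
          unfolding a_def by (intro sum_mono) (metis abs_ge_self abs_mult)
        also have "\<dots> \<le> L2_set c J * L2_set (fourier_coeff n \<phi>) J" by (rule L2_set_mult_ineq)
        finally show ?thesis by (simp add: L2_set_def W_def)
      qed
      then have "a\<^sup>2 \<le> (L2_set c J * sqrt W)\<^sup>2" using a by (intro power_mono) auto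
      also have "\<dots> = (\<Sum>S\<in>J. (c S)\<^sup>2) * W"
        using W0 by (simp add: L2_set_def power_mult_distrib sum_nonneg)
      finally have "(exp 1 ^ k)\<^sup>2 * a\<^sup>2 \<le> (exp 1 ^ k)\<^sup>2 * ((\<Sum>S\<in>J. (c S)\<^sup>2) * W)"
        by (rule mult_left_mono) simp
      also have "\<dots> = \<delta>\<^sup>2 * (\<Sum>S\<in>J. (c S)\<^sup>2)"
        using W0 by (simp add: \<delta>_def power_mult_distrib)
      \<comment> \<open>The squared 2-norm of \<open>p\<close> contains the square of its constant
        term as well. This makes the inequality strict, against the upper bound from
        \<open>L2_le_exp_L1\<close>.\<close>
      also have "\<dots> < a\<^sup>2 + \<delta>\<^sup>2 * (\<Sum>S\<in>J. (c S)\<^sup>2)" using a by simp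
      also have "\<dots> = (\<Sum>S\<in>Pow {1..n}. (p S)\<^sup>2)"
        using J' by (subst split) (auto simp: p_def sum_distrib_left power_mult_distrib intro!: sum.cong)
      also have "\<dots> \<le> (exp 1 ^ k * p {})\<^sup>2"
        by (rule L2_le_exp_L1[OF _ pos]) (auto simp: p_def J_def)
      finally show False by (simp add: p_def power_mult_distrib)
    qed
    from kwise_uniform_mixture[OF \<phi> \<delta>, of k, folded J_def, OF this] show ?thesis
      by (simp only: weight \<delta>_def)
  qed
qed

section \<open>From the Fourier weight to a uniform bound on the coefficients\<close>

text \<open>Every nonempty set of at most \<open>k\<close> elements is the image of a map from
  \<open>{..<k}\<close> to \<open>{1..n}\<close>, and there are \<open>n ^ k\<close> such
  maps.\<close>

lemma card_low_degree_sets_le: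
  "card {S. S \<subseteq> {1..n} \<and> 1 \<le> card S \<and> card S \<le> k} \<le> n ^ k"
proof -
  have "S \<in> (\<lambda>f. f ` {..<k}) ` ({..<k} \<rightarrow>\<^sub>E {1..n})"
    if S: "S \<subseteq> {1..n}" "1 \<le> card S" "card S \<le> k" for S
  proof -
    have fin: "finite S" using S by (auto intro: finite_subset)
    obtain g where g: "bij_betw g {..<card S} S"
      using ex_bij_betw_nat_finite[OF fin] by (auto simp: atLeast0LessThan)
    \<comment> \<open>An enumeration of \<open>S\<close> is padded to length \<open>k\<close> by
      repeating its first element, which exists because \<open>S\<close> is nonempty.\<close>
    define f where "f = (\<lambda>i\<in>{..<k}. g (if i < card S then i else 0))"
    have "f ` {..<k} = g ` {..<card S}"
      using S by (force simp: f_def image_iff)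
    then have "f ` {..<k} = S" using g by (simp add: bij_betw_def)
    moreover from this have "f \<in> {..<k} \<rightarrow>\<^sub>E {1..n}"
      using S(1) by (intro PiE_I) (blast, simp add: f_def)
    ultimately show ?thesis by blast
  qed
  then have "card {S. S \<subseteq> {1..n} \<and> 1 \<le> card S \<and> card S \<le> k}
      \<le> card ((\<lambda>f. f ` {..<k}) ` ({..<k} \<rightarrow>\<^sub>E {1..n}))"
    by (intro card_mono) (auto intro!: finite_PiE)
  also have "\<dots> \<le> card ({..<k} \<rightarrow>\<^sub>E {1..n})"
    by (intro card_image_le finite_PiE) auto
  also have "\<dots> = n ^ k" by (simp add: card_PiE)
  finally show ?thesis .
qed

lemma eps_kwise_uniform_nonneg:
  assumes "eps_kwise_uniform n \<epsilon> k \<phi>" "1 \<le> n" "1 \<le> k"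
  shows "0 \<le> \<epsilon>"
proof -
  have "\<bar>fourier_coeff n \<phi> {1}\<bar> \<le> \<epsilon>"
    using assms by (simp add: eps_kwise_uniform_def)
  then show ?thesis by linarith
qed

lemma sqrt_fourier_weight_le:
  assumes "eps_kwise_uniform n \<epsilon> k \<phi>" "1 \<le> n" "1 \<le> k"
  shows "sqrt (fourier_weight n 1 k \<phi>) \<le> real n powr (real k / 2) * \<epsilon>"
proof -
  have e: "0 \<le> \<epsilon>" using eps_kwise_uniform_nonneg assms .
  have "fourier_weight n 1 k \<phi> \<le> (\<Sum>S | S \<subseteq> {1..n} \<and> 1 \<le> card S \<and> card S \<le> k. \<epsilon>\<^sup>2)"
    unfolding fourier_weight_def
  proof (rule sum_mono)
    fix S assume "S \<in> {S. S \<subseteq> {1..n} \<and> 1 \<le> card S \<and> card S \<le> k}"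
    then have "\<bar>fourier_coeff n \<phi> S\<bar> \<le> \<bar>\<epsilon>\<bar>"
      using assms e by (auto simp: eps_kwise_uniform_def)
    then show "(fourier_coeff n \<phi> S)\<^sup>2 \<le> \<epsilon>\<^sup>2" by (simp add: abs_le_square_iff)
  qed
  also have "\<dots> \<le> real (n ^ k) * \<epsilon>\<^sup>2"
    using card_low_degree_sets_le[of n k]
    by (simp del: of_nat_power One_nat_def add: mult_right_mono)
  also have "real (n ^ k) = (real n powr (real k / 2))\<^sup>2"
    using assms(2) by (subst powr_power) (simp_all add: powr_realpow)
  also have "\<dots> * \<epsilon>\<^sup>2 = (real n powr (real k / 2) * \<epsilon>)\<^sup>2"
    by (rule power_mult_distrib[symmetric])
  finally show ?thesis using e by (intro real_le_lsqrt) auto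
qed

section \<open>The sharper bound for k = 1\<close>

text \<open>The index sets are the singletons, so each coordinate can be chosen separately with sign
  opposite to its coefficient. The left side becomes -\<epsilon> times the sum of the
  \<open>\<bar>c {i}\<bar>\<close>. With \<open>b\<close> the Fourier coefficients of a density,
  this is the hypothesis \<open>sep\<close> of \<open>kwise_uniform_mixture\<close>.\<close>

lemma exists_cube_point_linear_le:
  fixes c b :: "nat set \<Rightarrow> real"
  assumes "\<And>i. i \<in> {1..n} \<Longrightarrow> \<bar>b {i}\<bar> \<le> \<epsilon>"
  shows "\<exists>x\<in>cube n. \<epsilon> * (\<Sum>S | S \<subseteq> {1..n} \<and> 1 \<le> card S \<and> card S \<le> 1. c S * (\<Prod>i\<in>S. x i))
    \<le> - (\<Sum>S | S \<subseteq> {1..n} \<and> 1 \<le> card S \<and> card S \<le> 1. c S * b S)"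
proof -
  have sets: "{S. S \<subseteq> {1..n} \<and> 1 \<le> card S \<and> card S \<le> 1} = (\<lambda>i. {i}) ` {1..n}"
  proof -
    have "1 \<le> card S \<and> card S \<le> 1 \<longleftrightarrow> (\<exists>i. S = {i})" for S :: "nat set"
      by (metis card_1_singleton_iff One_nat_def le_antisym order_refl)
    then show ?thesis by auto
  qed
  define x :: "nat \<Rightarrow> real" where "x = (\<lambda>i\<in>{1..n}. if 0 \<le> c {i} then -1 else 1)"
  have "x \<in> cube n" by (auto simp: x_def cube_def)
  moreover have "\<epsilon> * (\<Sum>i\<in>{1..n}. c {i} * x i) \<le> - (\<Sum>i\<in>{1..n}. c {i} * b {i})"
    unfolding sum_distrib_left sum_negf[symmetric]
  proof (rule sum_mono)
    fix i assume i: "i \<in> {1..n}"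
    have "c {i} * b {i} \<le> \<bar>c {i}\<bar> * \<bar>b {i}\<bar>" by (metis abs_ge_self abs_mult)
    also have "\<dots> \<le> \<bar>c {i}\<bar> * \<epsilon>" using assms[OF i] by (rule mult_left_mono) simp
    also have "\<dots> = - (\<epsilon> * (c {i} * x i))" using i by (auto simp: x_def)
    finally show "\<epsilon> * (c {i} * x i) \<le> - (c {i} * b {i})" by simp
  qed
  ultimately show ?thesis
    unfolding sets by (intro bexI[of _ x]) (simp_all add: sum.reindex)
qed

lemma eps_1wise_uniform_near:
  assumes eps: "eps_kwise_uniform n \<epsilon> 1 \<phi>" and "1 \<le> n"
  shows "\<exists>\<psi>. kwise_uniform n 1 \<psi> \<and> close_to n \<epsilon> \<phi> \<psi>"
proof -
  have \<phi>: "density_fn n \<phi>" using eps by (simp add: eps_kwise_uniform_def)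
  consider "\<epsilon> = 0" | "0 < \<epsilon>" using eps_kwise_uniform_nonneg[OF assms] by fastforce
  then show ?thesis
  proof cases
    case 1
    then show ?thesis
      using kwise_uniform_self[OF \<phi>, of 1] eps by (auto simp: eps_kwise_uniform_def)
  next
    case 2
    have "\<bar>fourier_coeff n \<phi> {i}\<bar> \<le> \<epsilon>" if "i \<in> {1..n}" for i
      using eps that by (simp add: eps_kwise_uniform_def)
    then show ?thesis
      by (intro kwise_uniform_mixture[OF \<phi> 2] exists_cube_point_linear_le)
  qed
qed

theorem theorem1:
  fixes n k :: nat and \<phi> :: "(nat \<Rightarrow> real) \<Rightarrow> real"
  assumes "n \<ge> 1" and "k \<ge> 1" and "density_fn n \<phi>"
  shows "(\<exists>\<delta> \<psi>. kwise_uniform n k \<psi> \<and> close_to n \<delta> \<phi> \<psi> \<and>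
            \<delta> \<le> exp 1 ^ k * sqrt (fourier_weight n 1 k \<phi>))
       \<and> (\<forall>\<epsilon>. eps_kwise_uniform n \<epsilon> k \<phi> \<longrightarrow>
            (\<exists>\<delta> \<psi>. kwise_uniform n k \<psi> \<and> close_to n \<delta> \<phi> \<psi> \<and>
               \<delta> \<le> exp 1 ^ k * real n powr (real k / 2) * \<epsilon>))
       \<and> (\<forall>\<epsilon>. eps_kwise_uniform n \<epsilon> 1 \<phi> \<longrightarrow>
            (\<exists>\<psi>. kwise_uniform n 1 \<psi> \<and> close_to n \<epsilon> \<phi> \<psi>))"
proof -
  obtain \<psi> where \<psi>: "kwise_uniform n k \<psi>"
    "close_to n (exp 1 ^ k * sqrt (fourier_weight n 1 k \<phi>)) \<phi> \<psi>"
    using kwise_uniform_near_fourier_weight[OF assms(3)] by blast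
  \<comment> \<open>The same \<open>\<psi>\<close> and the same distance serve the first two claims;
    only the bound on the distance is weakened.\<close>
  have "exp 1 ^ k * sqrt (fourier_weight n 1 k \<phi>) \<le> exp 1 ^ k * real n powr (real k / 2) * \<epsilon>"
    if "eps_kwise_uniform n \<epsilon> k \<phi>" for \<epsilon>
    unfolding mult.assoc
    by (intro mult_left_mono sqrt_fourier_weight_le that assms) simp
  with \<psi> show ?thesis
    using eps_1wise_uniform_near assms(1) by blast
qed

end
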